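(* Let $(a_n)_{n\ge1}$ and $(b_n)_{n\ge1}$ be sequences of nonzero integers and put $c_n=\frac{a_n}{b_n}$ (so $c_n\neq 0$ for all $n$). Assume: (1) $b_n \mid b_{n+1}$ for all $n=1,2,\dots$; (2) $\lim_{n\to\infty} a_n\frac{c_{n+1}}{c_n}=0$; (3) for every natural number $N$, $\sum_{n=N}^{\infty}c_n\neq 0$. Then the series $\sum_{n=1}^{\infty}c_n$ converges and its sum is an irrational number. *)

theory Defs
  imports Complex_Main
begin

end

theory Submission
  imports Defs
begin

text \<open>
  Hypothesis (2) says that $b_N c_{N+1}$ tends to 0. Since $|a_n| \ge 1$, also
  $c_{n+1}/c_n$ tends to 0, so the series converges and its tail from $N+1$ on is
  eventually at most $2|c_{N+1}|$. If the sum were $p/q$, then $q b_N$ times this tail would be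
  an integer, because $b_n$ divides $b_N$ for all $n \le N$. It is nonzero by (3), but it tends to 0.
\<close>

text \<open>Iterating \<open>half\<close> gives domination by the geometric series |f 0| / 2^n,
  whose sum is 2 |f 0|. It will be applied to tails of \<open>c\<close>, where the bound is by the
  first term of the tail.\<close>

lemma summable_and_suminf_bound_of_halving:
  fixes f :: "nat \<Rightarrow> real"
  assumes half: "\<And>n. \<bar>f (Suc n)\<bar> \<le> \<bar>f n\<bar> / 2"
  shows "summable f" and "\<bar>suminf f\<bar> \<le> 2 * \<bar>f 0\<bar>"
proof -
  have bound: "\<bar>f n\<bar> \<le> \<bar>f 0\<bar> * (1/2) ^ n" for n
  proof (induction n)
    case (Suc n)
    then show ?case using half[of n] by simp
  qed simp
  have geo: "(\<lambda>n. \<bar>f 0\<bar> * (1/2) ^ n) sums (\<bar>f 0\<bar> * 2)"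
    using sums_mult[OF geometric_sums[of "1/2::real"]] by simp
  have abs_summable: "summable (\<lambda>n. \<bar>f n\<bar>)"
    by (rule summable_comparison_test'[OF sums_summable[OF geo], of 0]) (simp add: bound)
  then show "summable f"
    by (rule summable_rabs_cancel)
  have "\<bar>suminf f\<bar> \<le> (\<Sum>n. \<bar>f n\<bar>)"
    by (rule summable_rabs[OF abs_summable])
  also have "\<dots> \<le> (\<Sum>n. \<bar>f 0\<bar> * (1/2) ^ n)"
    by (rule suminf_le[OF bound abs_summable sums_summable[OF geo]])
  also have "\<dots> = 2 * \<bar>f 0\<bar>"
    using sums_unique[OF geo] by simp
  finally show "\<bar>suminf f\<bar> \<le> 2 * \<bar>f 0\<bar>" .
qed

text \<open>Induction: if b (n+1) = b n * d, passing to n+1 multiplies the previous integer by d and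
  adds the integer a (n+1). Only divisibility between neighbours is needed.\<close>

lemma denominator_times_partial_sum_in_Ints:
  fixes a b :: "nat \<Rightarrow> int"
  assumes b_nonzero: "\<And>n. b n \<noteq> 0" and b_dvd: "\<And>n. b n dvd b (Suc n)"
  shows "real_of_int (b n) * (\<Sum>k\<le>n. real_of_int (a k) / real_of_int (b k)) \<in> \<int>"
proof (induction n)
  case 0
  then show ?case using b_nonzero[of 0] by simp
next
  case (Suc n)
  obtain d where d: "b (Suc n) = b n * d"
    using b_dvd[of n] by (elim dvdE)
  have "real_of_int (b (Suc n)) * (\<Sum>k\<le>Suc n. real_of_int (a k) / real_of_int (b k))
      = real_of_int d * (real_of_int (b n) * (\<Sum>k\<le>n. real_of_int (a k) / real_of_int (b k)))
        + real_of_int (a (Suc n))"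
    using b_nonzero[of "Suc n"] by (simp add: distrib_left) (simp add: d)
  then show ?case
    using Suc.IH by simp
qed

theorem theorem1:
  fixes a b :: "nat \<Rightarrow> int" and c :: "nat \<Rightarrow> real"
  assumes a_nonzero: "\<And>n. n \<ge> 1 \<Longrightarrow> a n \<noteq> 0"
    and b_nonzero: "\<And>n. n \<ge> 1 \<Longrightarrow> b n \<noteq> 0"
    and c_eq: "\<And>n. n \<ge> 1 \<Longrightarrow> c n = real_of_int (a n) / real_of_int (b n)"
    and b_dvd: "\<And>n. n \<ge> 1 \<Longrightarrow> b n dvd b (n + 1)"
    and lim: "(\<lambda>n. real_of_int (a n) * (c (n + 1) / c n)) \<longlonglongrightarrow> 0"
    and tails: "\<And>N. N \<ge> 1 \<Longrightarrow> (\<Sum>n. c (N + n)) \<noteq> 0"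
  shows "summable (\<lambda>n. c (1 + n)) \<and> (\<Sum>n. c (1 + n)) \<notin> \<rat>"
proof -
  have c_nonzero: "c n \<noteq> 0" if "n \<ge> 1" for n
    using that a_nonzero b_nonzero c_eq by simp
  \<comment> \<open>Since a n / c n = b n, hypothesis \<open>lim\<close> controls the denominator
    times the next term, which is the quantity needed for the tail estimate.\<close>
  have ratio_eq: "real_of_int (a n) * (c (n + 1) / c n) = real_of_int (b n) * c (n + 1)"
    if "n \<ge> 1" for n
    using that a_nonzero[of n] b_nonzero[of n] c_eq[of n] by simp
  have eventually_small: "\<exists>M\<ge>1. \<forall>n\<ge>M. \<bar>real_of_int (a n) * (c (n + 1) / c n)\<bar> < e"
    if "e > 0" for e
  proof -
    obtain M where "\<forall>n\<ge>M. \<bar>real_of_int (a n) * (c (n + 1) / c n)\<bar> < e"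
      using LIMSEQ_D[OF lim \<open>e > 0\<close>] by auto
    \<comment> \<open>The other hypotheses start at index 1, so the threshold is raised to at least
      1.\<close>
    then show ?thesis by (intro exI[of _ "max M 1"]) auto
  qed
  obtain M where M: "M \<ge> 1"
    "\<And>n. n \<ge> M \<Longrightarrow> \<bar>real_of_int (a n) * (c (n + 1) / c n)\<bar> < 1/2"
    using eventually_small[of "1/2"] by auto
  have half: "\<bar>c (Suc n)\<bar> \<le> \<bar>c n\<bar> / 2" if "n \<ge> M" for n
  proof -
    have n: "n \<ge> 1" using that M(1) by simp
    \<comment> \<open>A nonzero integer has absolute value at least 1, so dropping the factor a n
      only decreases the product.\<close>
    have "1 \<le> \<bar>real_of_int (a n)\<bar>"
      using a_nonzero[OF n] by linarith
    then have "\<bar>c (n + 1) / c n\<bar> \<le> \<bar>real_of_int (a n)\<bar> * \<bar>c (n + 1) / c n\<bar>"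
      using mult_right_mono[of 1 "\<bar>real_of_int (a n)\<bar>" "\<bar>c (n + 1) / c n\<bar>"] by simp
    also have "\<dots> < 1/2"
      using M(2)[OF that] by (simp add: abs_mult)
    finally show ?thesis
      using c_nonzero[OF n] by (simp add: field_simps)
  qed
  have tail: "summable (\<lambda>n. c (N + n))" "\<bar>\<Sum>n. c (N + n)\<bar> \<le> 2 * \<bar>c N\<bar>" if "N \<ge> M" for N
    using summable_and_suminf_bound_of_halving[of "\<lambda>n. c (N + n)"] half that by simp_all
  have "summable c"
    using tail(1)[of M] summable_iff_shift[of c M] by (simp add: add.commute)
  then have summable: "summable (\<lambda>n. c (1 + n))"
    using summable_iff_shift[of c 1] by (simp add: add.commute)
  have "(\<Sum>n. c (1 + n)) \<notin> \<rat>"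
  proof
    assume "(\<Sum>n. c (1 + n)) \<in> \<rat>"
    then obtain p q :: int where q: "q > 0"
      and sum_eq: "(\<Sum>n. c (1 + n)) = real_of_int p / real_of_int q"
      by (elim Rats_cases') auto
    \<comment> \<open>The factor 2 q in the threshold absorbs the denominator q and the constant 2
      of the tail bound.\<close>
    obtain K where K: "K \<ge> 1"
      "\<And>n. n \<ge> K \<Longrightarrow> \<bar>real_of_int (a n) * (c (n + 1) / c n)\<bar> < 1 / (2 * real_of_int q)"
      using eventually_small[of "1 / (2 * real_of_int q)"] q by auto
    define m where "m = max K M"
    \<comment> \<open>S consists of c 1, ..., c m, exactly the terms whose denominators b m clears;
      T is the rest, starting at m + 1.\<close>
    define T where "T = (\<Sum>n. c (Suc m + n))"
    define S where "S = (\<Sum>k<m. c (1 + k))"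
    have m: "m \<ge> 1" "m \<ge> K" "m \<ge> M"
      using K(1) by (auto simp: m_def)
    have S_int: "real_of_int (b m) * S \<in> \<int>"
    proof -
      \<comment> \<open>The integrality lemma counts from 0 with an inclusive upper bound, so it is
        used for the shifted sequences at m - 1; here m \<ge> 1 ensures
        \<open>Suc (m - 1) = m\<close>.\<close>
      have "{..<m} = {..m - 1}" using m(1) by auto
      then have "S = (\<Sum>k\<le>m - 1. real_of_int (a (Suc k)) / real_of_int (b (Suc k)))"
        unfolding S_def by (simp add: c_eq)
      then show ?thesis
        using denominator_times_partial_sum_in_Ints
          [of "\<lambda>n. b (Suc n)" "m - 1" "\<lambda>n. a (Suc n)"] b_nonzero b_dvd m(1) by simp
    qed
    have "real_of_int p / real_of_int q = T + S"
      using suminf_split_initial_segment[OF summable, of m] sum_eq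
      by (simp add: T_def S_def add_ac)
    then have "real_of_int p = real_of_int q * (T + S)"
      using q by (simp add: field_simps)
    then have "real_of_int q * real_of_int (b m) * T
        = real_of_int (b m) * real_of_int p - real_of_int q * (real_of_int (b m) * S)"
      by (simp add: algebra_simps)
    also have "\<dots> \<in> \<int>"
      using S_int by simp
    finally have int: "real_of_int q * real_of_int (b m) * T \<in> \<int>" .
    have nonzero: "real_of_int q * real_of_int (b m) * T \<noteq> 0"
      using q b_nonzero[OF m(1)] tails[of "Suc m"] by (simp add: T_def)
    \<comment> \<open>A nonzero integer would have absolute value below 1: the tail bound leaves 2 q
      |b m * c (m+1)|, which \<open>ratio_eq\<close> turns into the quantity made small by the
      choice of K.\<close>
    have "\<bar>real_of_int q * real_of_int (b m) * T\<bar>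
        \<le> real_of_int q * \<bar>real_of_int (b m)\<bar> * (2 * \<bar>c (Suc m)\<bar>)"
      using tail(2)[of "Suc m"] m(3) q by (simp add: T_def abs_mult mult_left_mono)
    also have "\<dots> = 2 * real_of_int q * \<bar>real_of_int (a m) * (c (m + 1) / c m)\<bar>"
      unfolding ratio_eq[OF m(1)] by (simp add: abs_mult)
    also have "\<dots> < 1"
      using K(2)[OF m(2)] q by (simp add: field_simps)
    finally show False
      using Ints_nonzero_abs_ge1[OF int nonzero] by simp
  qed
  with summable show ?thesis by blast
qed

end
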